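(* Assume that $(\mathcal F_n)_{n\ge1}$ is an $\alpha$-regular atomic filtration, $\alpha\in(0,1]$. Let $f\in L^1(\mathcal F_\infty)$ with $\|f\|_{\mathrm{BMO}}<\infty$. Set $$c_1:=e,\qquad c_2:=\frac{\alpha}{e}.$$ Then for every $N\ge1$, every atom $A\in\mathcal A_N$, and every $t>0$, $$\mathbb P\bigl(\{\omega\in A:\ |f(\omega)-f_A|>t\}\bigr)\le c_1\exp\Bigl(-c_2\frac{t}{\|f\|_{\mathrm{BMO}}}\Bigr)\mathbb P(A).$$
   Context: $(\Omega,\mathcal F,\mathbb P)$ is a complete probability space with a discrete filtration $(\mathcal F_n)_{n\ge1}$, and $\mathcal F_\infty:=\sigma\bigl(\bigcup_{n\ge1}\mathcal F_n\bigr)$; $L^1(\mathcal F_\infty)$ denotes the $\mathcal F_\infty$-measurable functions in $L^1(\Omega,\mathbb P)$. The filtration is atomic: each $\mathcal F_n$ is generated by a countable measurable partition $\mathcal A_n$ of $\Omega$ into atoms, with $\mathbb P(A)>0$ for every $A\in\mathcal A_n$. An atomic filtration is $\alpha$-regular, for $\alpha\in(0,1]$, if for every $n\ge2$, every $P\in\mathcal A_{n-1}$ and every $C\in\mathcal A_n$ with $C\subseteq P$ one has $\mathbb P(C)\ge\alpha\,\mathbb P(P)$. For $A\in\mathcal A_n$ and $f\in L^1(\Omega,\mathbb P)$, $f_A:=\frac1{\mathbb P(A)}\mathbb E[f\mathbf 1_A]$. For $f\in L^1(\mathcal F_\infty)$, $$\|f\|_{\mathrm{BMO}}:=\sup_{n\ge1}\sup_{A\in\mathcal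 A_n}\frac1{\mathbb P(A)}\mathbb E\bigl[|f-f_A|\mathbf 1_A\bigr].$$ *)

theory Defs
  imports "HOL-Probability.Probability"
begin

text \<open>
  A filtration is a family \<open>F\<close> of sub-sigma-algebras of \<open>M\<close> indexed by \<open>n \<ge> 1\<close>; the value at
  index 0 is irrelevant throughout. \<open>\<A> n\<close> is the countable partition of atoms generating \<open>F n\<close>.
\<close>

definition atomic_filtration ::
  "'a measure \<Rightarrow> (nat \<Rightarrow> 'a measure) \<Rightarrow> (nat \<Rightarrow> 'a set set) \<Rightarrow> bool" where
  "atomic_filtration M F \<A> \<longleftrightarrow>
     filtration (space M) (\<lambda>n. F (Suc n)) \<and>
     (\<forall>n\<ge>1. subalgebra M (F n) \<and>
        countable (\<A> n) \<and> partition_on (space M) (\<A> n) \<and>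
        sets (F n) = sigma_sets (space M) (\<A> n) \<and>
        (\<forall>A\<in>\<A> n. measure M A > 0))"

definition regular_filtration ::
  "'a measure \<Rightarrow> (nat \<Rightarrow> 'a set set) \<Rightarrow> real \<Rightarrow> bool" where
  "regular_filtration M \<A> \<alpha> \<longleftrightarrow>
     (\<forall>n\<ge>2. \<forall>P\<in>\<A> (n - 1). \<forall>C\<in>\<A> n. C \<subseteq> P \<longrightarrow> measure M C \<ge> \<alpha> * measure M P)"

definition F_infinity :: "'a measure \<Rightarrow> (nat \<Rightarrow> 'a measure) \<Rightarrow> 'a measure" where
  "F_infinity M F = sigma (space M) (\<Union>n\<in>{1..}. sets (F n))"

definition set_mean :: "'a measure \<Rightarrow> ('a \<Rightarrow> real) \<Rightarrow> 'a set \<Rightarrow> real" where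
  "set_mean M f A = (LINT \<omega>:A|M. f \<omega>) / measure M A"

text \<open>The supremum is taken in \<open>ennreal\<close>, so that an unbounded oscillation gives \<open>\<infinity>\<close>.\<close>

definition bmo_norm ::
  "'a measure \<Rightarrow> (nat \<Rightarrow> 'a set set) \<Rightarrow> ('a \<Rightarrow> real) \<Rightarrow> ennreal" where
  "bmo_norm M \<A> f =
     (SUP n\<in>{1..}. SUP A\<in>\<A> n.
        ennreal ((LINT \<omega>:A|M. \<bar>f \<omega> - set_mean M f A\<bar>) / measure M A))"

end

theory Submission
  imports Defs
begin

text \<open>
  A John--Nirenberg argument by iterated stopping. Write \<open>b\<close> for the BMO norm and \<open>c = e b\<close>. Inside an
  atom \<open>A\<close> stop at the maximal atoms \<open>B\<close> on which the mean of \<open>\<bar>f - f\<^sub>A\<bar>\<close> exceeds \<open>c\<close>. They have total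
  measure at most \<open>P(A) / e\<close>, and almost everywhere outside them \<open>\<bar>f - f\<^sub>A\<bar> \<le> c\<close>. The parent of \<open>B\<close>
  was not stopped, so regularity gives \<open>\<bar>f\<^sub>B - f\<^sub>A\<bar> \<le> c / \<alpha>\<close>. Hence raising the level \<open>t\<close> by \<open>c / \<alpha>\<close>
  costs a factor \<open>1 / e\<close>, and iterating \<open>\<lfloor>\<alpha> t / (e b)\<rfloor>\<close> times yields the exponential bound.
\<close>

section \<open>Signs of integrals over countable unions\<close>

lemma set_integrable_of_integrable:
  fixes f :: "'a \<Rightarrow> real"
  assumes "integrable M f" "X \<in> sets M"
  shows "set_integrable M X f"
  unfolding set_integrable_def using assms(2,1) by (rule integrable_mult_indicator)

lemma set_integral_mono_subset:
  fixes f :: "'a \<Rightarrow> real"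
  assumes "integrable M f" "A \<in> sets M" "B \<in> sets M" "B \<subseteq> A" "\<And>x. 0 \<le> f x"
  shows "(LINT x:B|M. f x) \<le> (LINT x:A|M. f x)"
  using assms integrable_mult_indicator[of _ M f] unfolding set_lebesgue_integral_def
  by (intro integral_mono) (auto simp: indicator_def)

text \<open>Finite partial unions are additive over their members, and integrability of
  \<open>f\<close> over the whole union passes the sign to the limit.\<close>

lemma set_integral_Union_nonpos:
  fixes f :: "'a \<Rightarrow> real"
  assumes f: "integrable M f" and "countable \<B>" "disjoint \<B>" "\<B> \<subseteq> sets M"
    and le: "\<And>B. B \<in> \<B> \<Longrightarrow> (LINT x:B|M. f x) \<le> 0"
  shows "(LINT x:\<Union>\<B>|M. f x) \<le> 0"
proof (cases "\<B> = {}")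
  case False
  define B where "B i = from_nat_into \<B> i" for i
  have range_B: "range B = \<B>"
    unfolding B_def using range_from_nat_into[OF False \<open>countable \<B>\<close>] by simp
  define U where "U n = \<Union>(B ` {..<n})" for n
  have f_set: "set_integrable M X f" if "X \<in> sets M" for X
    using that f by (rule set_integrable_of_integrable[rotated])
  have B_sets: "B i \<in> sets M" for i
    using range_B assms(4) by blast
  have "(LINT x:U n|M. f x) \<le> 0" for n
  proof -
    \<comment> \<open>\<open>from_nat_into\<close> repeats members when \<B> is finite, so the sum
      below runs over the image set and not over indices.\<close>
    have "(LINT x:U n|M. f x) = (LINT x:(\<Union>C\<in>B ` {..<n}. C)|M. f x)"
      by (simp add: U_def)
    also have "\<dots> = (\<Sum>C\<in>B ` {..<n}. LINT x:C|M. f x)"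
      using \<open>disjoint \<B>\<close> range_B B_sets f_set
      by (intro set_integral_finite_Union)
        (auto simp: disjoint_family_on_def disjoint_def)
    also have "\<dots> \<le> 0"
      using le range_B by (intro sum_nonpos) blast
    finally show ?thesis .
  qed
  moreover have "(\<lambda>n. LINT x:U n|M. f x) \<longlonglongrightarrow> (LINT x:(\<Union>n. U n)|M. f x)"
  proof (rule set_integral_cont_up)
    show "incseq U" by (force simp: U_def incseq_def)
    show "U n \<in> sets M" for n using B_sets by (auto simp: U_def)
    then show "set_integrable M (\<Union>n. U n) f" by (intro f_set) auto
  qed
  moreover have "(\<Union>n. U n) = \<Union>\<B>"
    unfolding range_B[symmetric] U_def by auto
  ultimately show ?thesis
    by (metis LIMSEQ_le_const2)
qed (simp add: set_lebesgue_integral_def)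

section \<open>Approximation of generated sets by an algebra\<close>

text \<open>Induction on the generation of \<open>S\<close>. Complements keep the symmetric
  difference; a countable union is cut to finitely many members, each of which is then approximated
  with a smaller tolerance, so \<open>e\<close> has to vary.\<close>

lemma (in finite_measure) sigma_sets_approx:
  assumes G: "algebra \<Omega> G" "\<Omega> = space M" "G \<subseteq> sets M"
    and S: "S \<in> sigma_sets \<Omega> G" and "0 < e"
  shows "\<exists>T\<in>G. measure M (sym_diff S T) < e"
  using S \<open>0 < e\<close>
proof (induction arbitrary: e)
  case (Basic S)
  then show ?case by (intro bexI[of _ S]) auto
next
  case Empty
  then show ?case
    using G(1) by (intro bexI[of _ "{}"]) (auto simp: algebra_iff_Un)
next
  case (Compl S)
  then obtain T where T: "T \<in> G" "measure M (sym_diff S T) < e" by blast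
  have "T \<subseteq> \<Omega>" using T(1) G by (metis sets.sets_into_space subsetD)
  moreover have "S \<subseteq> \<Omega>"
    using Compl.hyps G by (metis sets.sets_into_space sets.sigma_sets_subset subsetD)
  ultimately have "sym_diff (\<Omega> - S) (\<Omega> - T) = sym_diff S T" by auto
  then show ?case
    using T algebra.compl_sets[OF G(1)] by (intro bexI[of _ "\<Omega> - T"]) auto
next
  case (Union S)
  have S_sets: "S i \<in> sets M" for i
    using Union.hyps[of i] G sets.sigma_sets_subset[of G M] by auto
  define U where "U k = \<Union>(S ` {..<k})" for k
  have U_sets: "U k \<in> sets M" for k using S_sets by (auto simp: U_def)
  have "(\<lambda>k. measure M (U k)) \<longlonglongrightarrow> measure M (\<Union>k. U k)"
  proof (rule finite_Lim_measure_incseq)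
    show "incseq U" by (force simp: U_def incseq_def)
  qed (use U_sets in auto)
  then obtain k where k: "\<bar>measure M (U k) - measure M (\<Union>k. U k)\<bar> < e / 2"
    using Union.prems unfolding LIMSEQ_iff by (metis half_gt_zero order_refl real_norm_def)
  have "(\<Union>k. U k) = (\<Union>i. S i)" by (auto simp: U_def)
  moreover have "measure M ((\<Union>i. S i) - U k) = measure M (\<Union>i. S i) - measure M (U k)"
    using U_sets S_sets by (intro finite_measure_Diff) (auto simp: U_def)
  ultimately have k': "measure M ((\<Union>i. S i) - U k) < e / 2"
    using k by (simp only:)
  \<comment> \<open>\<open>Suc k\<close> keeps the tolerance positive for \<open>k = 0\<close>. The
    \<open>k\<close> errors add up to at most \<open>e / 2\<close>; the other half pays for the
    tail.\<close>
  have "\<exists>T\<in>G. measure M (sym_diff (S i) T) < e / (2 * Suc k)" for i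
    using Union.IH[of "e / (2 * Suc k)" i] Union.prems by simp
  then obtain T where T: "\<And>i. T i \<in> G" "\<And>i. measure M (sym_diff (S i) (T i)) < e / (2 * Suc k)"
    by metis
  have T_sets: "T i \<in> sets M" for i using T(1) G by auto
  let ?V = "\<Union>(T ` {..<k})" and ?D = "\<lambda>i. sym_diff (S i) (T i)"
  have "?V \<in> G"
    using T(1) G(1) by (intro ring_of_sets.finite_Union algebra.axioms) auto
  moreover have "measure M (sym_diff (\<Union>i. S i) ?V) < e"
  proof -
    have "measure M (\<Union>i<k. ?D i) \<le> (\<Sum>i<k. measure M (?D i))"
      using S_sets T_sets by (intro finite_measure_subadditive_finite) auto
    also have "\<dots> \<le> (\<Sum>i<k. e / (2 * Suc k))"
      using T(2) by (intro sum_mono less_imp_le)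
    also have "\<dots> \<le> e / 2"
      using Union.prems by (simp add: field_simps)
    finally have "measure M (\<Union>i<k. ?D i) \<le> e / 2" .
    moreover have "measure M (sym_diff (\<Union>i. S i) ?V)
        \<le> measure M (((\<Union>i. S i) - U k) \<union> (\<Union>i<k. ?D i))"
      using S_sets T_sets U_sets by (intro finite_measure_mono) (auto simp: U_def)
    moreover have "\<dots> \<le> measure M ((\<Union>i. S i) - U k) + measure M (\<Union>i<k. ?D i)"
      using S_sets T_sets U_sets by (intro measure_Un_le) auto
    ultimately show ?thesis using k' by linarith
  qed
  ultimately show ?case by blast
qed

text \<open>Stands in for martingale convergence in the almost everywhere bound off the stopped atoms.\<close>

lemma set_integral_nonpos_sigma_sets:
  fixes f :: "'a \<Rightarrow> real"
  assumes f: "integrable M f"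
    and G: "algebra \<Omega> G" "\<Omega> = space M" "G \<subseteq> sets M"
    and le: "\<And>T. T \<in> G \<Longrightarrow> (LINT x:T|M. f x) \<le> 0"
    and S: "S \<in> sigma_sets \<Omega> G"
  shows "(LINT x:S|M. f x) \<le> 0"
proof (rule field_le_epsilon)
  fix e :: real assume "0 < e"
  have [measurable]: "f \<in> borel_measurable M" using f by auto
  \<comment> \<open>The \<open>Q\<close>-measure of a symmetric difference bounds the change of the
    integral of \<open>f\<close>, so the approximation is done in \<open>Q\<close>.\<close>
  define Q where "Q = density M (\<lambda>x. ennreal \<bar>f x\<bar>)"
  have Q_eq: "emeasure Q X = ennreal (LINT x:X|M. \<bar>f x\<bar>)" if "X \<in> sets M" for X
  proof -
    have "emeasure Q X = (\<integral>\<^sup>+x. ennreal (indicator X x * \<bar>f x\<bar>) \<partial>M)"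
      unfolding Q_def using that
      by (subst emeasure_density) (auto intro!: nn_integral_cong simp: indicator_def)
    also have "\<dots> = ennreal (LINT x:X|M. \<bar>f x\<bar>)"
      unfolding set_lebesgue_integral_def using integrable_mult_indicator[OF that integrable_abs[OF f]]
      by (subst nn_integral_eq_integral) auto
    finally show ?thesis .
  qed
  interpret Q: finite_measure Q
    by standard (simp add: Q_eq Q_def[THEN arg_cong[where f=space]])
  obtain T where T: "T \<in> G" "measure Q (sym_diff S T) < e"
    using Q.sigma_sets_approx[OF G(1) _ _ S \<open>0 < e\<close>] G(2,3) by (auto simp: Q_def)
  have [measurable]: "T \<in> sets M" "S \<in> sets M"
    using T(1) G S sets.sigma_sets_subset[of G M] by auto
  have fi: "set_integrable M X f" "set_integrable M X (\<lambda>x. \<bar>f x\<bar>)" if "X \<in> sets M" for X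
    using that f by (auto intro!: set_integrable_of_integrable)
  have "(LINT x:S|M. f x) - (LINT x:T|M. f x)
      = (LINT x|M. indicator S x * f x - indicator T x * f x)"
    unfolding set_lebesgue_integral_def
    using fi(1)[of S] fi(1)[of T] by (simp add: set_integrable_def)
  also have "\<dots> \<le> (LINT x:sym_diff S T|M. \<bar>f x\<bar>)"
    unfolding set_lebesgue_integral_def
    using fi(1)[of S] fi(1)[of T] fi(2)[of "sym_diff S T"]
    by (intro integral_mono) (auto simp: set_integrable_def indicator_def)
  also have "\<dots> = measure Q (sym_diff S T)"
    by (simp add: measure_def Q_eq set_lebesgue_integral_def)
  finally show "(LINT x:S|M. f x) \<le> 0 + e"
    using T le[OF T(1)] by linarith
qed


section \<open>Atoms and the sets they generate\<close>

text \<open>The sets that cut no block of the partition include the blocks and are closed under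
  complement and countable union.\<close>

lemma sigma_sets_partition_split:
  assumes "S \<in> sigma_sets \<Omega> \<P>" "partition_on \<Omega> \<P>" "B \<in> \<P>"
  shows "B \<subseteq> S \<or> B \<inter> S = {}"
  using assms(1)
proof induction
  case (Basic P)
  then show ?case using assms(2,3) by (auto simp: partition_on_def disjoint_def)
next
  case (Compl S)
  moreover have "B \<subseteq> \<Omega>" using assms(2,3) by (auto simp: partition_on_def)
  ultimately show ?case by auto
next
  case (Union S)
  then show ?case by blast
qed simp

locale atomic_prob_space = prob_space M
  for M :: "'a measure" and F :: "nat \<Rightarrow> 'a measure" and \<A> :: "nat \<Rightarrow> 'a set set" +
  assumes atomic: "atomic_filtration M F \<A>"
begin

lemma
  assumes "n \<ge> 1"
  shows sets_F: "sets (F n) = sigma_sets (space M) (\<A> n)"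
    and sets_F_subset: "sets (F n) \<subseteq> sets M"
    and space_F: "space (F n) = space M"
    and countable_atoms: "countable (\<A> n)"
    and partition_atoms: "partition_on (space M) (\<A> n)"
    and measure_atom_pos: "A \<in> \<A> n \<Longrightarrow> measure M A > 0"
  using assms atomic unfolding atomic_filtration_def subalgebra_def by auto

lemma F_mono:
  assumes "1 \<le> m" "m \<le> n"
  shows "sets (F m) \<subseteq> sets (F n)"
proof -
  have "filtration (space M) (\<lambda>n. F (Suc n))"
    using atomic by (simp add: atomic_filtration_def)
  \<comment> \<open>\<open>filtration\<close> holds for the shifted family, so both indices drop by
    one.\<close>
  from filtration.sets_F_mono[OF this, of "m - 1" "n - 1"] show ?thesis
    using assms by simp
qed

lemma atom_in_F:
  assumes "n \<ge> 1" "A \<in> \<A> n"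
  shows "A \<in> sets (F n)"
  using assms by (auto simp: sets_F)

lemma atom_in_M:
  assumes "n \<ge> 1" "A \<in> \<A> n"
  shows "A \<in> sets M"
  using assms atom_in_F sets_F_subset by blast

lemma atom_split:
  assumes "n \<ge> 1" "S \<in> sets (F n)" "B \<in> \<A> n"
  shows "B \<subseteq> S \<or> B \<inter> S = {}"
  using assms sigma_sets_partition_split partition_atoms sets_F by metis

text \<open>\<open>P\<close> also belongs to the finer \<open>F n\<close>, and a set of
  \<open>F n\<close> cannot cut an atom of level \<open>n\<close>.\<close>

lemma atom_refines:
  assumes "1 \<le> m" "m \<le> n" "P \<in> \<A> m" "B \<in> \<A> n" "B \<inter> P \<noteq> {}"
  shows "B \<subseteq> P"
  using atom_split[of n P B] F_mono[of m n] atom_in_F[of m P] assms by auto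

lemma atom_eq:
  assumes "n \<ge> 1" "P \<in> \<A> n" "B \<in> \<A> n" "B \<inter> P \<noteq> {}"
  shows "B = P"
  using partition_atoms[OF assms(1)] assms(2-) by (auto simp: partition_on_def disjoint_def)

lemma atom_nonempty: "n \<ge> 1 \<Longrightarrow> B \<in> \<A> n \<Longrightarrow> B \<noteq> {}"
  using partition_atoms by (auto simp: partition_on_def)

lemma atom_ancestor:
  assumes "1 \<le> m" "m \<le> n" "B \<in> \<A> n"
  obtains P where "P \<in> \<A> m" "B \<subseteq> P"
proof -
  obtain x where x: "x \<in> B" using atom_nonempty[of n B] assms by auto
  then have "x \<in> space M"
    using atom_in_M[of n B] assms sets.sets_into_space by fastforce
  then obtain P where "P \<in> \<A> m" "x \<in> P"
    using partition_atoms[OF assms(1)] by (auto simp: partition_on_def)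
  with atom_refines[OF assms(1,2) this(1) assms(3)] x that show ?thesis by blast
qed

text \<open>No atom is cut, so the atoms that meet \<open>S\<close> lie inside it. Integrals over
  \<open>S\<close> thereby reduce to integrals over atoms.\<close>

lemma Union_atoms:
  assumes "n \<ge> 1" "S \<in> sets (F n)"
  shows "\<Union>{B \<in> \<A> n. B \<subseteq> S} = S"
proof (intro equalityI subsetI)
  fix x assume x: "x \<in> S"
  then have "x \<in> space M"
    using assms sets_F_subset sets.sets_into_space by blast
  then obtain B where "B \<in> \<A> n" "x \<in> B"
    using partition_atoms[OF assms(1)] by (auto simp: partition_on_def)
  with atom_split[OF assms this(1)] x show "x \<in> \<Union>{B \<in> \<A> n. B \<subseteq> S}" by blast
qed auto

section \<open>The algebra generating \<open>F_infinity\<close>\<close>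

lemma Union_F_subset: "(\<Union>n\<in>{1..}. sets (F n)) \<subseteq> sets M"
  using sets_F_subset by auto

lemma sets_F_infinity: "sets (F_infinity M F) = sigma_sets (space M) (\<Union>n\<in>{1..}. sets (F n))"
  and space_F_infinity: "space (F_infinity M F) = space M"
proof -
  have "(\<Union>n\<in>{1..}. sets (F n)) \<subseteq> Pow (space M)"
    using Union_F_subset sets.space_closed by (rule order_trans)
  then show "sets (F_infinity M F) = sigma_sets (space M) (\<Union>n\<in>{1..}. sets (F n))"
    and "space (F_infinity M F) = space M"
    unfolding F_infinity_def by (auto simp: sets_measure_of space_measure_of)
qed

text \<open>The \<open>F n\<close> are nested, so any two sets already live in a common
  \<open>F (max m n)\<close>. An algebra is what the approximation argument starts from.\<close>

lemma algebra_Union_F: "algebra (space M) (\<Union>n\<in>{1..}. sets (F n))"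
proof (unfold algebra_iff_Un, intro conjI ballI)
  show "(\<Union>n\<in>{1..}. sets (F n)) \<subseteq> Pow (space M)"
    using Union_F_subset sets.space_closed by (rule order_trans)
  show "{} \<in> (\<Union>n\<in>{1..}. sets (F n))" by auto
next
  fix S assume "S \<in> (\<Union>n\<in>{1..}. sets (F n))"
  then show "space M - S \<in> (\<Union>n\<in>{1..}. sets (F n))"
    using space_F sets.compl_sets by (metis UN_iff atLeast_iff)
next
  fix S T assume "S \<in> (\<Union>n\<in>{1..}. sets (F n))" "T \<in> (\<Union>n\<in>{1..}. sets (F n))"
  then obtain m n where "1 \<le> m" "1 \<le> n" "S \<in> sets (F m)" "T \<in> sets (F n)" by auto
  then have "S \<in> sets (F (max m n))" "T \<in> sets (F (max m n))" "1 \<le> max m n"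
    using F_mono[of m "max m n"] F_mono[of n "max m n"] by auto
  then show "S \<union> T \<in> (\<Union>n\<in>{1..}. sets (F n))" by (meson UN_I atLeast_iff sets.Un)
qed

text \<open>The integral on the right is additive over disjoint atoms, unlike the mean, so bounds on
  means carry over to unions of atoms.\<close>

lemma set_mean_le_iff:
  fixes g :: "'a \<Rightarrow> real"
  assumes "integrable M g" "n \<ge> 1" "B \<in> \<A> n"
  shows "set_mean M g B \<le> c \<longleftrightarrow> (LINT x:B|M. g x - c) \<le> 0"
proof -
  have "(LINT x:B|M. g x - c) = (LINT x:B|M. g x) - c * measure M B"
    using assms atom_in_M[of n B]
    by (subst set_integral_diff)
      (auto intro!: set_integrable_of_integrable simp: set_lebesgue_integral_def)
  then show ?thesis
    using measure_atom_pos[OF assms(2,3)] by (simp add: set_mean_def divide_le_eq)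
qed

section \<open>Stopping at atoms with large mean\<close>

text \<open>The clause on the parent is what regularity acts on later. Off \<B>, every atom that
  avoids the atoms stopped so far has mean at most \<open>c\<close>; as \<open>g\<close> is
  measurable for \<open>F_infinity\<close>, this controls \<open>g\<close> almost
  everywhere.\<close>

lemma calderon_zygmund:
  fixes g :: "'a \<Rightarrow> real"
  assumes g: "integrable M g" "g \<in> borel_measurable (F_infinity M F)"
    and N: "N \<ge> 1" "A \<in> \<A> N" and mean_A: "set_mean M g A \<le> c"
  obtains \<B> where "countable \<B>" "disjoint \<B>"
    "\<And>B. B \<in> \<B> \<Longrightarrow> B \<subseteq> A \<and> c < set_mean M g B \<and>
       (\<exists>n>N. B \<in> \<A> n \<and> (\<exists>P\<in>\<A> (n - 1). B \<subseteq> P \<and> set_mean M g P \<le> c))"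
    "AE x in M. x \<in> A - \<Union>\<B> \<longrightarrow> g x \<le> c"
proof -
  define \<S> where "\<S> n = {B \<in> \<A> n. B \<subseteq> A \<and> c < set_mean M g B \<and>
    (\<forall>m\<in>{N..<n}. \<forall>P\<in>\<A> m. B \<subseteq> P \<longrightarrow> set_mean M g P \<le> c)}" for n
  define \<B> where "\<B> = (\<Union>n\<in>{N..}. \<S> n)"
  \<comment> \<open>\<open>E n\<close> is the part of \<open>A\<close> not stopped up to level
    \<open>n\<close>. It lies in \<open>F n\<close>, hence splits into atoms of level
    \<open>n\<close>.\<close>
  define E where "E n = A - \<Union>(\<Union>k\<in>{N..n}. \<S> k)" for n
  have E_iff: "x \<in> E n \<longleftrightarrow> x \<in> A \<and> (\<forall>j B. N \<le> j \<longrightarrow> j \<le> n \<longrightarrow> B \<in> \<S> j \<longrightarrow> x \<notin> B)" for x n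
    by (auto simp: E_def)
  have S_countable: "countable (\<S> n)" if "n \<ge> N" for n
    using countable_atoms[of n] N that by (auto simp: \<S>_def)
  have S_F: "\<S> k \<subseteq> sets (F n)" if "N \<le> k" "k \<le> n" for k n
    using that N atom_in_F[of k] F_mono[of k n] by (auto simp: \<S>_def)
  have E_F: "E n \<in> sets (F n)" if "n \<ge> N" for n
  proof -
    have "\<Union>(\<Union>k\<in>{N..n}. \<S> k) \<in> sets (F n)"
    proof (rule sets.countable_Union)
      show "(\<Union>k\<in>{N..n}. \<S> k) \<subseteq> sets (F n)"
        by (rule UN_least) (use S_F in simp)
    qed (use S_countable in auto)
    then show ?thesis
      using atom_in_F[OF N] F_mono[of N n] N that unfolding E_def by blast
  qed
  \<comment> \<open>Of two overlapping atoms stopped at different levels the finer lies inside the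
    coarser, whose mean above \<open>c\<close> rules out the later stop.\<close>
  have S_eq: "B = C" if "B \<in> \<S> m" "C \<in> \<S> n" "N \<le> m" "m \<le> n" "B \<inter> C \<noteq> {}" for B C m n
  proof (cases "m = n")
    case True
    then show ?thesis using that N atom_eq[of n C B] by (auto simp: \<S>_def)
  next
    case False
    have "C \<subseteq> B"
      using that N atom_refines[of m n B C] by (auto simp: \<S>_def)
    then show ?thesis using that False by (force simp: \<S>_def)
  qed
  have "disjoint \<B>"
  proof (rule disjointI)
    fix B C assume "B \<in> \<B>" "C \<in> \<B>" and "B \<noteq> C"
    then obtain m n where "N \<le> m" "N \<le> n" "B \<in> \<S> m" "C \<in> \<S> n"
      by (auto simp: \<B>_def)
    then show "B \<inter> C = {}"
      using S_eq[of B m C n] S_eq[of C n B m] \<open>B \<noteq> C\<close> by (cases "m \<le> n") auto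
  qed
  moreover have "countable \<B>"
    unfolding \<B>_def using S_countable by auto
  moreover have "B \<subseteq> A \<and> c < set_mean M g B \<and>
       (\<exists>n>N. B \<in> \<A> n \<and> (\<exists>P\<in>\<A> (n - 1). B \<subseteq> P \<and> set_mean M g P \<le> c))" if "B \<in> \<B>" for B
  proof -
    obtain n where n: "n \<ge> N" "B \<in> \<S> n" using \<open>B \<in> \<B>\<close> by (auto simp: \<B>_def)
    then have B: "B \<in> \<A> n" "B \<subseteq> A" "c < set_mean M g B" by (auto simp: \<S>_def)
    \<comment> \<open>The only atom of level \<open>N\<close> inside \<open>A\<close> is
      \<open>A\<close> itself, whose mean is at most \<open>c\<close>. So the parent has level
      \<open>n - 1\<close>, still at least \<open>N\<close>.\<close>
    have "n \<noteq> N"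
      using B N mean_A atom_eq[of N A B] atom_nonempty[of N B] by force
    with n have "n > N" by simp
    then have "1 \<le> n - 1" "n - 1 \<le> n" using N(1) by linarith+
    then obtain P where "P \<in> \<A> (n - 1)" "B \<subseteq> P"
      using B(1) by (rule atom_ancestor)
    moreover from this have "set_mean M g P \<le> c"
      using n(2) \<open>n > N\<close> unfolding \<S>_def by (auto dest!: bspec[of _ _ "n - 1"])
    ultimately show ?thesis using B \<open>n > N\<close> by blast
  qed
  moreover have "AE x in M. x \<in> A - \<Union>\<B> \<longrightarrow> g x \<le> c"
  proof -
    have mean_le: "set_mean M g C \<le> c" if n: "n \<ge> N" and C: "C \<in> \<A> n" "C \<subseteq> E n" for n C
    proof (rule ccontr)
      assume not_le: "\<not> set_mean M g C \<le> c"
      \<comment> \<open>The coarsest atom containing \<open>C\<close>, from level \<open>N\<close>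
        on, with mean above \<open>c\<close> would be a stopped atom, against
        \<open>C \<subseteq> E n\<close>.\<close>
      define Q where "Q m \<longleftrightarrow> m \<ge> N \<and> m \<le> n \<and> (\<exists>P\<in>\<A> m. C \<subseteq> P \<and> c < set_mean M g P)" for m
      have "Q n" using n C not_le by (auto simp: Q_def)
      define m where "m = (LEAST m. Q m)"
      have "Q m" unfolding m_def using \<open>Q n\<close> by (rule LeastI)
      then obtain P where P: "P \<in> \<A> m" "C \<subseteq> P" "c < set_mean M g P" "N \<le> m" "m \<le> n"
        by (auto simp: Q_def)
      have "C \<noteq> {}" "C \<subseteq> A"
        using atom_nonempty[of n C] n N C by (auto simp: E_def)
      then have "P \<subseteq> A"
        using atom_refines[of N m A P] N P by auto
      moreover have "set_mean M g P' \<le> c" if "k \<in> {N..<m}" "P' \<in> \<A> k" "P \<subseteq> P'" for k P'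
      proof -
        have "\<not> Q k" using that not_less_Least[of k Q] by (auto simp: m_def)
        moreover have "C \<subseteq> P'" using P(2) that(3) by blast
        ultimately show ?thesis using that(1,2) P(4,5) unfolding Q_def by (simp add: not_less)
      qed
      ultimately have "P \<in> \<S> m" using P by (auto simp: \<S>_def)
      then show False using P C \<open>C \<noteq> {}\<close> by (force simp: E_def)
    qed
    define E' where "E' = A - \<Union>\<B>"
    have A_M: "A \<in> sets M" using atom_in_M N by auto
    have \<B>_M: "\<B> \<subseteq> sets M"
      unfolding \<B>_def
    proof (rule UN_least)
      fix k assume "k \<in> {N..}"
      then show "\<S> k \<subseteq> sets M" using S_F[of k k] sets_F_subset[of k] N(1) by simp
    qed
    have E'_M [measurable]: "E' \<in> sets M"
      unfolding E'_def using \<B>_M \<open>countable \<B>\<close> A_M by (auto intro: sets.countable_Union)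
    have gc: "integrable M (\<lambda>x. g x - c)" using g by auto
    have le0: "(LINT x:S \<inter> E n|M. g x - c) \<le> 0" if "n \<ge> N" "S \<in> sets (F n)" for S n
    proof -
      have n: "n \<ge> 1" using that N by auto
      have "S \<inter> E n \<in> sets (F n)" using that E_F by auto
      then have "\<Union>{C \<in> \<A> n. C \<subseteq> S \<inter> E n} = S \<inter> E n" by (rule Union_atoms[OF n])
      moreover have "(LINT x:\<Union>{C \<in> \<A> n. C \<subseteq> S \<inter> E n}|M. g x - c) \<le> 0"
      proof (rule set_integral_Union_nonpos[OF gc])
        show "countable {C \<in> \<A> n. C \<subseteq> S \<inter> E n}" using countable_atoms[OF n] by auto
        show "disjoint {C \<in> \<A> n. C \<subseteq> S \<inter> E n}"
          using atom_eq[OF n] by (auto simp: disjoint_def)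
        show "{C \<in> \<A> n. C \<subseteq> S \<inter> E n} \<subseteq> sets M" using atom_in_M[OF n] by auto
      next
        fix C assume "C \<in> {C \<in> \<A> n. C \<subseteq> S \<inter> E n}"
        then show "(LINT x:C|M. g x - c) \<le> 0"
          using mean_le[of n C] set_mean_le_iff[OF g(1) n] that by auto
      qed
      ultimately show ?thesis by (simp only:)
    qed
    have le0': "(LINT x:S|M. indicator E' x * (g x - c)) \<le> 0"
      if "S \<in> (\<Union>n\<in>{1..}. sets (F n))" for S
    proof -
      obtain n where n: "n \<ge> 1" "S \<in> sets (F n)" using \<open>S \<in> _\<close> by auto
      \<comment> \<open>From this level on \<open>S\<close> is measurable at every level
        \<open>k + i\<close>, and the sets \<open>E (k + i)\<close> decrease to
        \<open>E'\<close>.\<close>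
      define k where "k = max n N"
      have k: "n \<le> k + i" "N \<le> k + i" "1 \<le> k + i" for i
        unfolding k_def using N(1) by linarith+
      have S_F': "S \<in> sets (F (k + i))" for i
        using n(2) F_mono[OF n(1), of "k + i"] k(1)[of i] by blast
      have SE_M: "S \<inter> E (k + i) \<in> sets M" for i
        using S_F'[of i] E_F[OF k(2)] sets_F_subset[OF k(3)] by blast
      have "(\<lambda>i. LINT x:S \<inter> E (k + i)|M. g x - c)
          \<longlonglongrightarrow> (LINT x:(\<Inter>i. S \<inter> E (k + i))|M. g x - c)"
      proof (rule set_integral_cont_down)
        show "decseq (\<lambda>i. S \<inter> E (k + i))"
          unfolding decseq_def by (intro allI impI subsetI) (auto simp: E_iff)
        show "set_integrable M (S \<inter> E (k + 0)) (\<lambda>x. g x - c)"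
          using gc SE_M by (rule set_integrable_of_integrable)
      qed (rule SE_M)
      moreover have "(LINT x:S \<inter> E (k + i)|M. g x - c) \<le> 0" for i
        using le0[OF k(2) S_F'] .
      ultimately have "(LINT x:(\<Inter>i. S \<inter> E (k + i))|M. g x - c) \<le> 0"
        by (intro LIMSEQ_le_const2) auto
      moreover have "(\<Inter>i. S \<inter> E (k + i)) = S \<inter> E'"
      proof (intro equalityI subsetI)
        fix x assume x: "x \<in> (\<Inter>i. S \<inter> E (k + i))"
        have "x \<notin> B" if "j \<ge> N" "B \<in> \<S> j" for j B
        proof -
          have "x \<in> E (k + j)" using x by blast
          then show ?thesis using that by (simp add: E_iff)
        qed
        moreover have "x \<in> S" "x \<in> A" using x by (auto simp: E_iff)
        ultimately show "x \<in> S \<inter> E'" by (auto simp: E'_def \<B>_def)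
      qed (auto simp: E'_def \<B>_def E_iff)
      ultimately have "(LINT x:S \<inter> E'|M. g x - c) \<le> 0" by (simp only:)
      then show ?thesis
        by (simp add: set_lebesgue_integral_def indicator_inter_arith mult.assoc)
    qed
    \<comment> \<open>On this test set the integrand is nonnegative, yet its integral is at most
      zero, so it vanishes almost everywhere. Measurability of \<open>g\<close> for
      \<open>F_infinity\<close> makes the test set admissible.\<close>
    define S where "S = {x \<in> space M. c < g x}"
    have "{x \<in> space (F_infinity M F). c < g x} \<in> sets (F_infinity M F)"
      using g(2) by measurable
    then have S_gen: "S \<in> sigma_sets (space M) (\<Union>n\<in>{1..}. sets (F n))"
      by (simp add: S_def sets_F_infinity space_F_infinity)
    have int: "integrable M (\<lambda>x. indicator E' x * (g x - c))"
      using integrable_mult_indicator[OF E'_M gc] by simp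
    have "(LINT x:S|M. indicator E' x * (g x - c)) \<le> 0"
      using set_integral_nonpos_sigma_sets[OF int algebra_Union_F refl Union_F_subset le0' S_gen] .
    moreover have S_M: "S \<in> sets M"
      using g(1) unfolding S_def by measurable
    let ?h = "\<lambda>x. indicator S x * (indicator E' x * (g x - c))"
    have h_int: "integrable M ?h"
      using integrable_mult_indicator[OF S_M int] by simp
    have h_nonneg: "0 \<le> ?h x" for x by (auto simp: S_def indicator_def)
    ultimately have "(LINT x|M. ?h x) = 0"
      using integral_nonneg_AE[of ?h M]
      by (intro antisym) (auto simp: set_lebesgue_integral_def)
    then have "AE x in M. ?h x = 0"
      using integral_nonneg_eq_0_iff_AE[OF h_int] h_nonneg by simp
    then show ?thesis
      using AE_space by eventually_elim (auto simp: S_def E'_def indicator_def split: if_splits)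
  qed
  ultimately show ?thesis using that by blast
qed


section \<open>Iteration of the stopping argument\<close>

text \<open>Induction on \<open>k\<close>: each stopped atom becomes the new starting atom, with its
  own mean and with the level lowered by \<open>exp 1 * b / \<alpha>\<close>, so \<open>N\<close>,
  \<open>A\<close> and \<open>t\<close> must vary.\<close>

lemma oscillation_decay:
  fixes f :: "'a \<Rightarrow> real"
  assumes f: "integrable M f" "f \<in> borel_measurable (F_infinity M F)"
    and reg: "0 < \<alpha>" "\<alpha> \<le> 1" "regular_filtration M \<A> \<alpha>"
    and "0 < b"
    and osc: "\<And>n A. n \<ge> 1 \<Longrightarrow> A \<in> \<A> n \<Longrightarrow> set_mean M (\<lambda>x. \<bar>f x - set_mean M f A\<bar>) A \<le> b"
    and "N \<ge> 1" "A \<in> \<A> N" "real k * (exp 1 * b / \<alpha>) \<le> t"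
  shows "prob {x \<in> A. t < \<bar>f x - set_mean M f A\<bar>} \<le> exp (- real k) * prob A"
  using assms(8-10)
proof (induction k arbitrary: N A t)
  case 0
  then show ?case
    using atom_in_M by (auto intro!: finite_measure_mono)
next
  case (Suc k)
  note N = \<open>N \<ge> 1\<close> \<open>A \<in> \<A> N\<close>
  \<comment> \<open>The factor \<open>exp 1\<close> makes \<open>b / c\<close> equal to
    \<open>exp (- 1)\<close>, the gain of one step.\<close>
  define c where "c = exp 1 * b"
  define g where "g = (\<lambda>x. \<bar>f x - set_mean M f A\<bar>)"
  define X where "X = {x \<in> A. t < g x}"
  have "b \<le> c" "0 < c" using \<open>0 < b\<close> by (auto simp: c_def)
  \<comment> \<open>One step \<open>c / \<alpha>\<close> is at least \<open>c\<close>, hence so is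
    \<open>t\<close>, and almost every point of \<open>X\<close> lies in a stopped atom.\<close>
  have "c \<le> c / \<alpha>" using reg \<open>0 < c\<close> by (simp add: pos_le_divide_eq mult_left_le)
  have t: "real k * (c / \<alpha>) \<le> t - c / \<alpha>"
    using Suc.prems(3) by (simp add: c_def algebra_simps add_divide_distrib)
  moreover have "0 \<le> real k * (c / \<alpha>)" using \<open>0 < c\<close> reg by simp
  ultimately have "c \<le> t" using \<open>c \<le> c / \<alpha>\<close> by linarith
  have g: "integrable M g" "g \<in> borel_measurable (F_infinity M F)"
    using f unfolding g_def by auto
  have mean_A: "set_mean M g A \<le> b"
    using osc[OF N] by (simp add: g_def)
  with \<open>b \<le> c\<close> have "set_mean M g A \<le> c" by linarith
  from calderon_zygmund[OF g N this] obtain \<B> where \<B>: "countable \<B>" "disjoint \<B>"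
    "\<And>B. B \<in> \<B> \<Longrightarrow> B \<subseteq> A \<and> c < set_mean M g B \<and>
       (\<exists>n>N. B \<in> \<A> n \<and> (\<exists>P\<in>\<A> (n - 1). B \<subseteq> P \<and> set_mean M g P \<le> c))"
    and AE_le: "AE x in M. x \<in> A - \<Union>\<B> \<longrightarrow> g x \<le> c"
    by blast
  have A_M: "A \<in> sets M" using atom_in_M[OF N] .
  have [measurable]: "f \<in> borel_measurable M" "g \<in> borel_measurable M" using f g by auto
  have X_M [measurable]: "X \<in> sets M"
  proof -
    have "X = A \<inter> {x \<in> space M. t < g x}"
      using sets.sets_into_space[OF A_M] by (auto simp: X_def)
    then show ?thesis using A_M by simp
  qed
  have \<B>_M: "\<B> \<subseteq> sets M"
    using \<B>(3) N(1) atom_in_M by (meson le_trans less_imp_le subsetI)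
  have UB_M: "\<Union>\<B> \<in> sets M" using \<B>(1) \<B>_M by (rule sets.countable_Union)
  \<comment> \<open>The bound uses the integral of \<open>g\<close> over \<open>B\<close> instead of
    \<open>prob B\<close>, so that summing over \<B> leaves an integral bounded by that over
    \<open>A\<close>.\<close>
  have XB: "prob (X \<inter> B) \<le> exp (- real k) / c * (LINT x:B|M. g x)" if "B \<in> \<B>" for B
  proof -
    obtain n P where n: "n > N" "B \<in> \<A> n" and P: "P \<in> \<A> (n - 1)" "B \<subseteq> P" "set_mean M g P \<le> c"
      using \<B>(3)[OF \<open>B \<in> \<B>\<close>] by blast
    have n1: "n \<ge> 1" "n - 1 \<ge> 1" "n \<ge> 2" using n N by linarith+
    have B_M: "B \<in> sets M" and P_M: "P \<in> sets M" using atom_in_M n1 n P by blast+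
    have pos: "prob B > 0" "prob P > 0" using measure_atom_pos n1 n P by blast+
    have "\<bar>set_mean M f B - set_mean M f A\<bar> * prob B = \<bar>LINT x:B|M. f x - set_mean M f A\<bar>"
    proof -
      have "(LINT x:B|M. f x - set_mean M f A) = (set_mean M f B - set_mean M f A) * prob B"
        using pos f B_M
        by (subst set_integral_diff)
          (auto intro!: set_integrable_of_integrable
            simp: set_mean_def set_lebesgue_integral_def left_diff_distrib)
      then show ?thesis by (simp add: abs_mult)
    qed
    also have "\<dots> \<le> (LINT x:B|M. g x)"
      using integral_abs_bound[of M "\<lambda>x. indicator B x * (f x - set_mean M f A)"]
      by (simp add: set_lebesgue_integral_def g_def abs_mult)
    \<comment> \<open>The parent has mean at most \<open>c\<close>; regularity then returns to
      \<open>prob B\<close> at the price \<open>1 / \<alpha>\<close>.\<close>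
    also have "\<dots> \<le> (LINT x:P|M. g x)"
      using g B_M P_M P(2) by (intro set_integral_mono_subset) (auto simp: g_def)
    also have "\<dots> \<le> c * prob P"
      using P(3) pos by (simp add: set_mean_def divide_le_eq)
    also have "\<dots> \<le> (c / \<alpha>) * prob B"
    proof -
      have "\<alpha> * prob P \<le> prob B"
        using reg(3) n1(3) P(1,2) n(2) by (auto simp: regular_filtration_def)
      then show ?thesis using reg(1) \<open>0 < c\<close> by (simp add: field_simps)
    qed
    finally have mean_diff: "\<bar>set_mean M f B - set_mean M f A\<bar> \<le> c / \<alpha>"
      using pos(1) by (rule mult_right_le_imp_le)
    have "prob (X \<inter> B) \<le> prob {x \<in> B. t - c / \<alpha> < \<bar>f x - set_mean M f B\<bar>}"
    proof (rule finite_measure_mono)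
      show "X \<inter> B \<subseteq> {x \<in> B. t - c / \<alpha> < \<bar>f x - set_mean M f B\<bar>}"
        using mean_diff by (auto simp: X_def g_def)
      have "{x \<in> B. t - c / \<alpha> < \<bar>f x - set_mean M f B\<bar>}
          = B \<inter> {x \<in> space M. t - c / \<alpha> < \<bar>f x - set_mean M f B\<bar>}"
        using sets.sets_into_space[OF B_M] by auto
      then show "{x \<in> B. t - c / \<alpha> < \<bar>f x - set_mean M f B\<bar>} \<in> sets M" using B_M by simp
    qed
    also have "\<dots> \<le> exp (- real k) * prob B"
      using Suc.IH[OF n1(1) n(2)] t by (simp add: c_def)
    \<comment> \<open>\<open>B\<close> was stopped, so the mean of \<open>g\<close> over it exceeds
      \<open>c\<close>.\<close>
    also have "\<dots> \<le> exp (- real k) * ((LINT x:B|M. g x) / c)"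
    proof -
      have "c * prob B \<le> (LINT x:B|M. g x)"
        using \<B>(3)[OF that] pos(1) by (simp add: set_mean_def less_divide_eq)
      then show ?thesis using \<open>0 < c\<close> by (intro mult_left_mono) (auto simp: field_simps)
    qed
    finally show ?thesis by simp
  qed
  have X_integrable: "integrable M (indicator X :: 'a \<Rightarrow> real)"
    using X_M by (intro integrable_real_indicator) (auto simp: less_top[symmetric])
  have X_int: "(LINT x:Y|M. indicator X x - exp (- real k) / c * g x)
      = prob (X \<inter> Y) - exp (- real k) / c * (LINT x:Y|M. g x)" if "Y \<in> sets M" for Y
  proof -
    have "(LINT x:Y|M. indicator X x :: real) = prob (X \<inter> Y)"
      using that X_M by (simp add: set_lebesgue_integral_def indicator_inter_arith[symmetric] Int_commute)
    then show ?thesis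
      using that g X_integrable
      by (subst set_integral_diff) (auto intro!: set_integrable_of_integrable)
  qed
  \<comment> \<open>Summation of the bounds \<open>XB\<close> is phrased as the sign of a single
    integral over the disjoint union.\<close>
  have "(LINT x:\<Union>\<B>|M. indicator X x - exp (- real k) / c * g x) \<le> 0"
    using \<B>(1,2) \<B>_M XB X_int g X_integrable
    by (intro set_integral_Union_nonpos Bochner_Integration.integrable_diff) auto
  then have "prob (X \<inter> \<Union>\<B>) \<le> exp (- real k) / c * (LINT x:\<Union>\<B>|M. g x)"
    using X_int[OF UB_M] by simp
  also have "\<dots> \<le> exp (- real k) / c * (LINT x:A|M. g x)"
    using \<open>0 < c\<close> g A_M UB_M \<B>(3)
    by (intro mult_left_mono set_integral_mono_subset) (auto simp: g_def)
  also have "\<dots> \<le> exp (- real k) / c * (b * prob A)"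
    using mean_A measure_atom_pos[OF N] \<open>0 < c\<close>
    by (intro mult_left_mono) (auto simp: set_mean_def divide_le_eq)
  also have "\<dots> = exp (- real (Suc k)) * prob A"
    using \<open>0 < b\<close> by (simp add: c_def exp_add exp_diff exp_minus field_simps)
  finally have "prob (X \<inter> \<Union>\<B>) \<le> exp (- real (Suc k)) * prob A" .
  moreover have "prob X \<le> prob (X \<inter> \<Union>\<B>)"
  proof (rule finite_measure_mono_AE)
    show "AE x in M. x \<in> X \<longrightarrow> x \<in> X \<inter> \<Union>\<B>"
      using AE_le by eventually_elim (use \<open>c \<le> t\<close> in \<open>force simp: X_def\<close>)
  qed (use X_M UB_M in auto)
  ultimately show ?case by (simp add: X_def g_def)
qed

section \<open>Oscillations bounded by the BMO norm\<close>

text \<open>Each atom gives one term of the supremum. Finiteness lets the bound pass to the reals,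
  since \<open>enn2real\<close> sends infinity to \<open>0\<close>.\<close>

lemma set_mean_oscillation_le_bmo:
  assumes "bmo_norm M \<A> f < \<infinity>" "n \<ge> 1" "A \<in> \<A> n"
  shows "set_mean M (\<lambda>x. \<bar>f x - set_mean M f A\<bar>) A \<le> enn2real (bmo_norm M \<A> f)"
proof -
  have "ennreal (set_mean M (\<lambda>x. \<bar>f x - set_mean M f A\<bar>) A) \<le> bmo_norm M \<A> f"
    unfolding bmo_norm_def set_mean_def[of M "\<lambda>x. \<bar>f x - set_mean M f A\<bar>"]
    using assms(2,3) by (intro SUP_upper2[of n] SUP_upper2[of A]) auto
  then have "ennreal (set_mean M (\<lambda>x. \<bar>f x - set_mean M f A\<bar>) A)
      \<le> ennreal (enn2real (bmo_norm M \<A> f))"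
    using assms(1) by simp
  then show ?thesis by (simp add: ennreal_le_iff)
qed

text \<open>Serves the case of norm zero: a nonnegative function with integral zero vanishes almost
  everywhere.\<close>

lemma AE_eq_set_mean:
  fixes f :: "'a \<Rightarrow> real"
  assumes f: "integrable M f" and A: "n \<ge> 1" "A \<in> \<A> n"
    and zero: "set_mean M (\<lambda>x. \<bar>f x - set_mean M f A\<bar>) A \<le> 0"
  shows "AE x in M. x \<in> A \<longrightarrow> f x = set_mean M f A"
proof -
  let ?h = "\<lambda>x. indicator A x * \<bar>f x - set_mean M f A\<bar>"
  have int: "integrable M ?h"
    using integrable_mult_indicator[OF atom_in_M[OF A], of "\<lambda>x. \<bar>f x - set_mean M f A\<bar>"] f
    by simp
  have "(LINT x|M. ?h x) \<le> 0"
    using zero measure_atom_pos[OF A]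
    by (simp add: set_mean_def[of M "\<lambda>x. \<bar>f x - set_mean M f A\<bar>"] divide_le_0_iff
        set_lebesgue_integral_def)
  moreover have "(LINT x|M. ?h x) \<ge> 0" by simp
  ultimately have "AE x in M. ?h x = 0"
    using integral_nonneg_eq_0_iff_AE[OF int] by simp
  then show ?thesis by eventually_elim auto
qed

end

section \<open>The exponential bound at every level \<open>t\<close>\<close>

theorem theorem5p12:
  fixes M :: "'a measure" and F :: "nat \<Rightarrow> 'a measure" and \<A> :: "nat \<Rightarrow> 'a set set"
    and \<alpha> :: real and f :: "'a \<Rightarrow> real"
  assumes "prob_space M" and "complete_measure M"
    and "atomic_filtration M F \<A>"
    and "0 < \<alpha>" and "\<alpha> \<le> 1" and "regular_filtration M \<A> \<alpha>"
    and "f \<in> borel_measurable (F_infinity M F)" and "integrable M f"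
    and "bmo_norm M \<A> f < \<infinity>"
  shows "let c1 = exp 1; c2 = \<alpha> / exp 1; b = enn2real (bmo_norm M \<A> f) in
    \<forall>N\<ge>1. \<forall>A\<in>\<A> N. \<forall>t>0.
      measure M {\<omega>\<in>A. \<bar>f \<omega> - set_mean M f A\<bar> > t}
        \<le> (if b = 0 then 0 else c1 * exp (- c2 * (t / b)) * measure M A)"
proof -
  interpret atomic_prob_space M F \<A>
    using assms(1,3) by (simp add: atomic_prob_space_def atomic_prob_space_axioms_def)
  define b where "b = enn2real (bmo_norm M \<A> f)"
  note osc = set_mean_oscillation_le_bmo[OF assms(9), folded b_def]
  have "prob {\<omega>\<in>A. \<bar>f \<omega> - set_mean M f A\<bar> > t}
      \<le> (if b = 0 then 0 else exp 1 * exp (- (\<alpha> / exp 1) * (t / b)) * prob A)"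
    if N: "N \<ge> 1" "A \<in> \<A> N" and "t > 0" for N A t
  proof (cases "b = 0")
    \<comment> \<open>Here \<open>t / b\<close> would be \<open>0\<close> by convention; the bound
      \<open>0\<close> is the limit value of the exponential instead, and holds as \<open>f\<close>
      is almost everywhere constant on \<open>A\<close>.\<close>
    case True
    then have "AE x in M. x \<in> A \<longrightarrow> f x = set_mean M f A"
      using AE_eq_set_mean[OF assms(8) N] osc[OF N] by simp
    then have "AE x in M. x \<in> {\<omega>\<in>A. \<bar>f \<omega> - set_mean M f A\<bar> > t} \<longrightarrow> x \<in> {}"
      by eventually_elim (use \<open>t > 0\<close> in auto)
    then have "prob {\<omega>\<in>A. \<bar>f \<omega> - set_mean M f A\<bar> > t} \<le> prob {}"
      by (rule finite_measure_mono_AE) simp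
    then show ?thesis using True by simp
  next
    case False
    then have "b > 0" by (simp add: b_def less_le)
    define s where "s = \<alpha> / exp 1 * (t / b)"
    have "s \<ge> 0" using \<open>b > 0\<close> \<open>t > 0\<close> assms(4) by (simp add: s_def)
    \<comment> \<open>\<open>s\<close> measures \<open>t\<close> in steps of size
      \<open>exp 1 * b / \<alpha>\<close>. Rounding down loses at most one step, that is one factor
      \<open>exp 1\<close>, which is the constant \<open>c1\<close>.\<close>
    define k where "k = nat \<lfloor>s\<rfloor>"
    have k: "real k \<le> s" "s \<le> real k + 1" using \<open>s \<ge> 0\<close> by (auto simp: k_def)
    have "real k * (exp 1 * b / \<alpha>) \<le> s * (exp 1 * b / \<alpha>)"
      using k(1) \<open>b > 0\<close> assms(4) by (intro mult_right_mono) auto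
    also have "\<dots> = t" using \<open>b > 0\<close> assms(4) by (simp add: s_def)
    finally have "prob {\<omega>\<in>A. \<bar>f \<omega> - set_mean M f A\<bar> > t} \<le> exp (- real k) * prob A"
      using oscillation_decay[OF assms(8,7,4-6) \<open>b > 0\<close> osc N] by simp
    also have "\<dots> \<le> exp (1 - s) * prob A"
      using k(2) by (intro mult_right_mono) auto
    also have "exp (1 - s) = exp 1 * exp (- (\<alpha> / exp 1) * (t / b))"
      by (simp add: s_def flip: exp_add)
    finally show ?thesis using False by simp
  qed
  then show ?thesis unfolding b_def Let_def by blast
qed

end
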